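(* For any Borel probability measure $\mu$ on $\Sigma_m$, the telescopic product measure $\mathbb{P}_\mu$ is exact and its dimension is equal to $$\dim_{H}\mathbb{P}_{\mu}=\frac{(q-1)^2}{\log m}\sum_{k=1}^{\infty}\frac{H_k(\mu)}{q^{k+1}},$$ where $$H_k(\mu)=-\sum_{a_1,\dots,a_k\in S}\mu([a_1\cdots a_k])\log \mu([a_1\cdots a_k]).$$
   Context: Let $m\ge2$, $q\ge2$ be integers, $S=\{0,1,\dots,m-1\}$, and let $\Sigma_m$ be the space of one-sided infinite sequences over $S$. For a finite word $u$ over $S$, $[u]$ denotes the cylinder of all sequences starting with $u$. $\log$ is the natural logarithm, $\log_m$ the logarithm in base $m$, and $0\log 0=0$. Telescopic product measure: index sequences in $\Sigma_m$ as $x=(x_n)_{n\ge1}$. For $i\ge1$ with $q\nmid i$ let $\Lambda_i=\{iq^j:j\ge0\}$; these sets partition $\{1,2,\dots\}$, so $\Sigma_m=\prod_{i\ge1,\,q\nmid i}S^{\Lambda_i}$, and each $S^{\Lambda_i}$ is identified with $\Sigma_m$ by listing the coordinates $x_i,x_{iq},x_{iq^2},\dots$ in this order. Given a probability measure $\mu$ on $\Sigma_m$, $\mathbb{P}_\mu$ is the probability measure on $\Sigma_m$ that is the product of copies of $\mu$ on the factors $S^{\Lambda_i}$; that is, for each word $u=u_1\cdots u_n$, $$\mathbb{P}_\mu([u])=\prod_{i\le n,\ q\nmid i}\mu([u_{|\Lambda_i}]),$$ where $u_{|\Lambda_i}=u_iu_{iq}\cdots u_{iq^r}$ with $r$ the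 largest integer such that $iq^r\le n$. A probability measure $\nu$ on $\Sigma_m$ is called exact if there is $\alpha\in\mathbb{R}$ such that $\lim_{n\to\infty}\frac{-\log_m\nu([x_1\cdots x_n])}{n}=\alpha$ for $\nu$-a.e. $x$; the value $\alpha$ is then the dimension $\dim_H\nu$ of $\nu$ (equivalently, the minimal Hausdorff dimension of Borel sets of full $\nu$-measure, for the standard metric on $\Sigma_m$ in which cylinders of length $n$ have diameter $m^{-n}$). *)

theory Defs
  imports "HOL-Probability.Probability" "HOL-Computational_Algebra.Factorial_Ring"
begin

text \<open>
  Sequences \<open>(x\<^sub>n)\<^sub>n\<^sub>\<ge>\<^sub>1\<close> over \<open>{0,...,m-1}\<close> are functions on the positive naturals, extended by
  \<open>undefined\<close> at \<open>0\<close>.  The index set is countable and the alphabet finite and discrete, so the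
  product sigma-algebra is the Borel sigma-algebra of the product topology.
\<close>

definition seq_space :: "nat \<Rightarrow> (nat \<Rightarrow> nat) measure" where
  "seq_space m = PiM {1..} (\<lambda>_. count_space {..<m})"

text \<open>Lists are indexed from \<open>0\<close>, sequences from \<open>1\<close>.\<close>

definition cylinder :: "nat \<Rightarrow> nat list \<Rightarrow> (nat \<Rightarrow> nat) set" where
  "cylinder m u = {x \<in> space (seq_space m). \<forall>j<length u. x (Suc j) = u ! j}"

definition words :: "nat \<Rightarrow> nat \<Rightarrow> nat list set" where
  "words m k = {u. length u = k \<and> set u \<subseteq> {..<m}}"

definition initial_word :: "(nat \<Rightarrow> nat) \<Rightarrow> nat \<Rightarrow> nat list" where
  "initial_word x n = map x [1..<Suc n]"

text \<open>The convention \<open>0 log 0 = 0\<close> is automatic here.\<close>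

definition block_entropy :: "nat \<Rightarrow> (nat \<Rightarrow> nat) measure \<Rightarrow> nat \<Rightarrow> real" where
  "block_entropy m \<mu> k =
     - (\<Sum>u\<in>words m k. measure \<mu> (cylinder m u) * ln (measure \<mu> (cylinder m u)))"

definition index_heads :: "nat \<Rightarrow> nat set" where
  "index_heads q = {i. 1 \<le> i \<and> \<not> q dvd i}"

text \<open>
  The identification of a family \<open>(\<omega>\<^sub>i)\<close> of sequences, indexed by the \<open>i\<close> not divisible by \<open>q\<close>,
  with the sequence \<open>x\<close> such that \<open>x\<close> at \<open>i * q ^ j\<close> is the \<open>(j+1)\<close>-st term of \<open>\<omega>\<^sub>i\<close>:
  every \<open>n \<ge> 1\<close> is \<open>i * q ^ j\<close> with \<open>j = multiplicity q n\<close>, also when \<open>q\<close> is not prime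
  (see \<open>telescopic_glue_apply\<close> below).
\<close>

definition telescopic_glue :: "nat \<Rightarrow> (nat \<Rightarrow> nat \<Rightarrow> nat) \<Rightarrow> nat \<Rightarrow> nat" where
  "telescopic_glue q \<omega> =
     (\<lambda>n\<in>{1..}. \<omega> (n div q ^ multiplicity q n) (Suc (multiplicity q n)))"

definition telescopic_measure ::
    "nat \<Rightarrow> nat \<Rightarrow> (nat \<Rightarrow> nat) measure \<Rightarrow> (nat \<Rightarrow> nat) measure" where
  "telescopic_measure m q \<mu> =
     distr (PiM (index_heads q) (\<lambda>_. \<mu>)) (seq_space m) (telescopic_glue q)"

text \<open>
  Almost every sequence has all its initial cylinders of positive measure (there are only
  countably many cylinders), so the value \<open>log m 0 = 0\<close> plays no role below.
\<close>

definition has_local_dimension_ae :: "nat \<Rightarrow> (nat \<Rightarrow> nat) measure \<Rightarrow> real \<Rightarrow> bool" where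
  "has_local_dimension_ae m \<nu> \<alpha> \<longleftrightarrow>
     (AE x in \<nu>. (\<lambda>n. - log (real m) (measure \<nu> (cylinder m (initial_word x n))) / real n)
        \<longlonglongrightarrow> \<alpha>)"

definition exact_measure :: "nat \<Rightarrow> (nat \<Rightarrow> nat) measure \<Rightarrow> bool" where
  "exact_measure m \<nu> \<longleftrightarrow>
     sets \<nu> = sets (seq_space m) \<and> prob_space \<nu> \<and> (\<exists>\<alpha>. has_local_dimension_ae m \<nu> \<alpha>)"

text \<open>Only meaningful for exact measures, for which the value is unique.\<close>

definition exact_dimension :: "nat \<Rightarrow> (nat \<Rightarrow> nat) measure \<Rightarrow> real" where
  "exact_dimension m \<nu> = (THE \<alpha>. has_local_dimension_ae m \<nu> \<alpha>)"


lemma exact_dimension_eqI: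
  assumes "prob_space \<nu>" and \<alpha>: "has_local_dimension_ae m \<nu> \<alpha>"
  shows "exact_dimension m \<nu> = \<alpha>"
  unfolding exact_dimension_def
proof (rule the_equality)
  interpret prob_space \<nu> by fact
  show "has_local_dimension_ae m \<nu> \<alpha>" by fact
  fix \<beta> assume "has_local_dimension_ae m \<nu> \<beta>"
  with \<alpha> have "AE x in \<nu>. \<beta> = \<alpha>"
    unfolding has_local_dimension_ae_def by eventually_elim (rule LIMSEQ_unique)
  then show "\<beta> = \<alpha>" by simp
qed

lemma telescopic_glue_apply:
  assumes "2 \<le> q" "i \<in> index_heads q"
  shows "telescopic_glue q \<omega> (i * q ^ j) = \<omega> i (Suc j)"
proof -
  have "multiplicity q (i * q ^ j) = j"
    using assms by (intro multiplicity_decomposeI[where x' = i]) (auto simp: index_heads_def)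
  then show ?thesis
    using assms by (auto simp: telescopic_glue_def index_heads_def)
qed

lemma index_heads_decompose:
  assumes "2 \<le> q" "1 \<le> n"
  obtains i j where "i \<in> index_heads q" "n = i * q ^ j"
proof -
  obtain y where y: "n = q ^ multiplicity q n * y" "\<not> q dvd y"
    using multiplicity_decompose'[of n q] assms by auto
  moreover have "1 \<le> y" using y assms by (cases y) auto
  ultimately show thesis
    by (intro that[of y "multiplicity q n"]) (auto simp: index_heads_def mult.commute)
qed

lemma telescopic_glue_measurable:
  assumes q: "2 \<le> q" and sets: "sets \<mu> = sets (seq_space m)"
  shows "telescopic_glue q \<in> measurable (PiM (index_heads q) (\<lambda>_. \<mu>)) (seq_space m)"
  unfolding telescopic_glue_def seq_space_def
proof (rule measurable_restrict)
  fix n :: nat assume "n \<in> {1..}"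
  then obtain i j where ij: "i \<in> index_heads q" "n = i * q ^ j"
    using index_heads_decompose[OF q] by auto
  let ?M = "PiM (index_heads q) (\<lambda>_. \<mu>)"
  have mult: "multiplicity q n = j"
    using q ij by (intro multiplicity_decomposeI[where x' = i]) (auto simp: index_heads_def)
  then have dv: "n div q ^ multiplicity q n = i" using ij q by simp
  have "(\<lambda>x. x (Suc j)) \<in> measurable \<mu> (count_space {..<m})"
    unfolding measurable_cong_sets[OF sets refl] seq_space_def
    by (rule measurable_component_singleton) simp
  then have "(\<lambda>\<omega>. \<omega> i (Suc j)) \<in> measurable ?M (count_space {..<m})"
    by (rule measurable_compose[OF measurable_component_singleton[OF ij(1)]])
  then show "(\<lambda>\<omega>. \<omega> (n div q ^ multiplicity q n) (Suc (multiplicity q n)))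
      \<in> measurable ?M (count_space {..<m})"
    unfolding dv unfolding mult .
qed

lemma sets_telescopic_measure: "sets (telescopic_measure m q \<mu>) = sets (seq_space m)"
  by (simp add: telescopic_measure_def)

lemma prob_space_telescopic_measure:
  assumes "2 \<le> q" "sets \<mu> = sets (seq_space m)" "prob_space \<mu>"
  shows "prob_space (telescopic_measure m q \<mu>)"
  unfolding telescopic_measure_def
  by (intro prob_space.prob_space_distr prob_space_PiM telescopic_glue_measurable assms)

lemma cylinder_measurable: "cylinder m u \<in> sets (seq_space m)"
proof -
  have "{x \<in> space (seq_space m). x (Suc j) = u ! j} \<in> sets (seq_space m)" for j
  proof -
    have *: "(\<lambda>x. x (Suc j)) \<in> measurable (seq_space m) (count_space {..<m})"
      unfolding seq_space_def by (rule measurable_component_singleton) simp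
    have "{u ! j} \<inter> {..<m} \<in> sets (count_space {..<m})" by simp
    from measurable_sets[OF * this] measurable_space[OF *] show ?thesis
      by (auto elim!: back_subst[of "\<lambda>A. A \<in> sets (seq_space m)"])
  qed
  then show ?thesis
    unfolding cylinder_def by (intro sets.sets_Collect_countable_All sets.sets_Collect_imp) auto
qed

text \<open>The subword \<open>u\<^sub>i u\<^sub>i\<^sub>q u\<^sub>i\<^sub>q\<^sub>q ...\<close> of \<open>u\<close>.\<close>

definition telescopic_subword :: "nat \<Rightarrow> nat \<Rightarrow> nat list \<Rightarrow> nat list" where
  "telescopic_subword q i u =
     map (\<lambda>j. u ! (i * q ^ j - 1)) [0..<Suc (GREATEST r. i * q ^ r \<le> length u)]"

lemma telescopic_measure_cylinder:
  assumes q: "2 \<le> q" and sets: "sets \<mu> = sets (seq_space m)" and "prob_space \<mu>"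
  shows "measure (telescopic_measure m q \<mu>) (cylinder m u) =
    (\<Prod>i\<in>{i \<in> index_heads q. i \<le> length u}. measure \<mu> (cylinder m (telescopic_subword q i u)))"
proof -
  interpret prob_space \<mu> by fact
  interpret P: product_prob_space "\<lambda>_. \<mu>" "index_heads q" by unfold_locales
  let ?J = "{i \<in> index_heads q. i \<le> length u}"
  let ?C = "\<lambda>i. cylinder m (telescopic_subword q i u)"
  let ?M = "PiM (index_heads q) (\<lambda>_. \<mu>)"
  have space: "space \<mu> = space (seq_space m)" by (rule sets_eq_imp_space_eq[OF sets])
  have idx: "j < length (telescopic_subword q i u) \<longleftrightarrow> i * q ^ j \<le> length u"
    if "i \<in> ?J" for i j
  proof -
    let ?r = "GREATEST r. i * q ^ r \<le> length u"
    have bound: "r \<le> length u" if "i * q ^ r \<le> length u" for r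
    proof -
      have "r < q ^ r" using q by (simp add: power_gt_expt)
      also have "q ^ r \<le> i * q ^ r" using \<open>i \<in> ?J\<close> by (auto simp: index_heads_def)
      finally show ?thesis using that by simp
    qed
    have r: "i * q ^ ?r \<le> length u"
      by (rule GreatestI_nat[where k = 0 and b = "length u"]) (use bound that in auto)
    have "j \<le> ?r" if "i * q ^ j \<le> length u"
      by (rule Greatest_le_nat[where b = "length u"]) (use bound that in auto)
    moreover have "i * q ^ j \<le> length u" if "j \<le> ?r"
    proof -
      have "i * q ^ j \<le> i * q ^ ?r" using that q by (intro mult_left_mono power_increasing) auto
      with r show ?thesis by (rule le_trans[rotated])
    qed
    ultimately show ?thesis by (auto simp: telescopic_subword_def less_Suc_eq_le)
  qed
  have nth: "telescopic_subword q i u ! j = u ! (i * q ^ j - 1)"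
    if "j < length (telescopic_subword q i u)" for i j
    using that by (simp add: telescopic_subword_def del: upt_Suc)
  have "telescopic_glue q -` cylinder m u \<inter> space ?M
      = prod_emb (index_heads q) (\<lambda>_. \<mu>) ?J (PiE ?J ?C)"
  proof (intro set_eqI)
    fix \<omega>
    have "telescopic_glue q \<omega> \<in> cylinder m u \<longleftrightarrow> (\<forall>i\<in>?J. \<omega> i \<in> ?C i)"
      if \<omega>: "\<omega> \<in> space ?M"
    proof -
      have "telescopic_glue q \<omega> \<in> space (seq_space m)"
        using telescopic_glue_measurable[OF q sets] \<omega> by (rule measurable_space)
      moreover have "\<omega> i \<in> space (seq_space m)" if "i \<in> ?J" for i
        using \<omega> that by (auto simp: space_PiM space)
      moreover have "(\<forall>k<length u. telescopic_glue q \<omega> (Suc k) = u ! k) \<longleftrightarrow>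
          (\<forall>i\<in>?J. \<forall>j. i * q ^ j \<le> length u \<longrightarrow> \<omega> i (Suc j) = u ! (i * q ^ j - 1))"
        (is "?L \<longleftrightarrow> ?R")
      proof
        assume L: ?L
        show ?R
        proof (intro ballI allI impI)
          fix i j assume ij: "i \<in> ?J" "i * q ^ j \<le> length u"
          then have "0 < i * q ^ j" using q by (auto simp: index_heads_def)
          with ij(2) have "i * q ^ j - 1 < length u" "Suc (i * q ^ j - 1) = i * q ^ j" by linarith+
          with L have "telescopic_glue q \<omega> (i * q ^ j) = u ! (i * q ^ j - 1)" by metis
          with ij telescopic_glue_apply[OF q, of i \<omega> j]
          show "\<omega> i (Suc j) = u ! (i * q ^ j - 1)" by simp
        qed
      next
        assume R: ?R
        show ?L
        proof (intro allI impI)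
          fix k assume k: "k < length u"
          obtain i j where ij: "i \<in> index_heads q" "Suc k = i * q ^ j"
            using index_heads_decompose[OF q, of "Suc k"] by auto
          have "i \<le> i * q ^ j" using q by simp
          then have "i \<le> length u" using ij(2) k by linarith
          with ij have "i \<in> ?J" by simp
          with R ij k have "\<omega> i (Suc j) = u ! (i * q ^ j - 1)" by (metis Suc_leI)
          then show "telescopic_glue q \<omega> (Suc k) = u ! k"
            using telescopic_glue_apply[OF q ij(1), of \<omega> j] ij(2)[symmetric] by simp
        qed
      qed
      ultimately show ?thesis
        unfolding cylinder_def using idx nth by auto
    qed
    then show "\<omega> \<in> telescopic_glue q -` cylinder m u \<inter> space ?M \<longleftrightarrow>
        \<omega> \<in> prod_emb (index_heads q) (\<lambda>_. \<mu>) ?J (PiE ?J ?C)"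
      by (auto simp: prod_emb_def space_PiM PiE_iff restrict_def extensional_def)
  qed
  moreover have "finite ?J" by (rule finite_subset[of _ "{..length u}"]) auto
  ultimately show ?thesis
    unfolding telescopic_measure_def
    using P.measure_PiM_emb[of ?J ?C]
    by (simp add: measure_distr telescopic_glue_measurable[OF q sets] cylinder_measurable sets)
qed

end

theory Submission
  imports Defs "HOL-Library.Discrete_Functions" "HOL-Real_Asymp.Real_Asymp"
begin

text \<open>
  For \<open>\<nu> = telescopic_measure m q \<mu>\<close> write \<open>L\<^sub>n x = - ln \<nu>[x\<^sub>1 \<dots> x\<^sub>n]\<close>.  The product formula for
  cylinders says that, when \<open>x\<close> is glued from independent sequences \<open>\<omega>\<^sub>i\<close> with law \<open>\<mu>\<close>, the
  number \<open>L\<^sub>n x\<close> is the sum over the heads \<open>i \<le> n\<close> of the information \<open>- ln \<mu>[\<dots>]\<close> carried by the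
  first \<open>k\<close> letters of \<open>\<omega>\<^sub>i\<close>, where \<open>k\<close> is the number of elements \<open>\<le> n\<close> of the chain
  \<open>i, i q, i q\<^sup>2, \<dots>\<close> (\<open>telescopic_information_eq_sum\<close>).  So \<open>L\<^sub>n\<close> is a sum of independent
  variables, and the claim is a law of large numbers for \<open>L\<^sub>n / n\<close>.

  Mean.  Asymptotically a fraction \<open>(q - 1)\<^sup>2 / q\<^sup>k\<^sup>+\<^sup>1\<close> of all \<open>i \<le> n\<close> are heads of a chain with exactly \<open>k\<close>
  elements up to \<open>n\<close> (\<open>tendsto_chain_count\<close>), and such a head contributes \<open>H\<^sub>k(\<mu>)\<close> to the expectation.
  Tannery's theorem gives the limit of the normalized expectations
  (\<open>tendsto_average_over_heads\<close>).

  Fluctuation.  The second moment of the information of \<open>k\<close> letters is \<open>O(k\<^sup>2)\<close>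
  (\<open>block_information_second_moment\<close>), while the number of chains of length \<open>k\<close> decays like \<open>n / q\<^sup>k\<close>.
  Hence the variance of \<open>L\<^sub>n\<close> is \<open>O(n)\<close>.  This makes the variances of \<open>L\<^sub>n / n\<close> summable along
  the squares \<open>n = l\<^sup>2\<close>, where therefore \<open>L\<^sub>n / n\<close> converges almost surely.  Since cylinders shrink,
  \<open>L\<^sub>n\<close> is nondecreasing in \<open>n\<close>, and this monotonicity fills the gaps between consecutive squares
  (\<open>strong_law_mono\<close>).
\<close>

section \<open>A strong law along a monotone sequence\<close>

text \<open>
  Consecutive squares have ratio tending to \<open>1\<close>, so the values of a monotone sequence between
  two squares are squeezed.
\<close>

lemma mono_limit_along_squares:
  fixes a :: "nat \<Rightarrow> real"
  assumes "mono a" and lim: "(\<lambda>l. a (l\<^sup>2) / real (l\<^sup>2)) \<longlonglongrightarrow> \<alpha>"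
  shows "(\<lambda>n. a n / real n) \<longlonglongrightarrow> \<alpha>"
proof -
  let ?s = "\<lambda>n. floor_sqrt n"
  have s_top: "filterlim ?s at_top sequentially"
    unfolding filterlim_at_top
  proof
    fix Z :: nat
    show "eventually (\<lambda>n. Z \<le> ?s n) sequentially"
      using eventually_ge_at_top[of "Z\<^sup>2"] by eventually_elim (rule le_floor_sqrtI)
  qed
  have Suc_top: "filterlim (\<lambda>n. Suc (?s n)) at_top sequentially"
    by (rule filterlim_compose[OF filterlim_Suc s_top])
  \<comment> \<open>With \<open>s = floor_sqrt n\<close> one has \<open>s\<^sup>2 \<le> n < (s + 1)\<^sup>2\<close>, so \<open>s\<^sup>2 / n\<close> and \<open>n / (s + 1)\<^sup>2\<close> both lie
    between the following quotient and \<open>1\<close>.\<close>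
  let ?\<rho> = "\<lambda>s::nat. (real s)\<^sup>2 / (real s + 1)\<^sup>2"
  have \<rho>: "(\<lambda>n. ?\<rho> (?s n)) \<longlonglongrightarrow> 1"
    by (rule filterlim_compose[OF _ s_top]) real_asymp
  have le: "real ((?s n)\<^sup>2) \<le> real n" for n
    by (simp only: of_nat_le_iff floor_sqrt_power2_le)
  have gt: "real n \<le> real ((Suc (?s n))\<^sup>2)" for n
    by (simp only: of_nat_le_iff Suc_floor_sqrt_power2_gt less_imp_le)
  have lower: "(\<lambda>n. real ((?s n)\<^sup>2) / real n) \<longlonglongrightarrow> 1"
  proof (rule tendsto_sandwich[OF _ _ \<rho> tendsto_const])
    show "eventually (\<lambda>n. ?\<rho> (?s n) \<le> real ((?s n)\<^sup>2) / real n) sequentially"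
      using eventually_gt_at_top[of 0]
    proof eventually_elim
      case (elim n)
      then show ?case using gt[of n]
        by (simp add: frac_le algebra_simps)
    qed
    show "eventually (\<lambda>n. real ((?s n)\<^sup>2) / real n \<le> 1) sequentially"
      using eventually_gt_at_top[of 0] by eventually_elim (use le in auto)
  qed
  have upper: "(\<lambda>n. real ((Suc (?s n))\<^sup>2) / real n) \<longlonglongrightarrow> 1"
  proof (rule tendsto_sandwich[OF _ _ tendsto_const])
    show "(\<lambda>n. inverse (?\<rho> (?s n))) \<longlonglongrightarrow> 1"
      using tendsto_inverse[OF \<rho>] by simp
    show "eventually (\<lambda>n. real ((Suc (?s n))\<^sup>2) / real n \<le> inverse (?\<rho> (?s n))) sequentially"
      using eventually_gt_at_top[of 0]
    proof eventually_elim
      case (elim n)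
      then show ?case using le[of n]
        by (simp add: frac_le algebra_simps)
    qed
    show "eventually (\<lambda>n. 1 \<le> real ((Suc (?s n))\<^sup>2) / real n) sequentially"
      using eventually_gt_at_top[of 0]
      by eventually_elim (use gt in \<open>auto simp del: of_nat_power of_nat_Suc\<close>)
  qed
  show ?thesis
  proof (rule tendsto_sandwich)
    show "(\<lambda>n. a ((?s n)\<^sup>2) / real ((?s n)\<^sup>2) * (real ((?s n)\<^sup>2) / real n)) \<longlonglongrightarrow> \<alpha>"
      using tendsto_mult[OF filterlim_compose[OF lim s_top] lower] by simp
    show "(\<lambda>n. a ((Suc (?s n))\<^sup>2) / real ((Suc (?s n))\<^sup>2) * (real ((Suc (?s n))\<^sup>2) / real n)) \<longlonglongrightarrow> \<alpha>"
      using tendsto_mult[OF filterlim_compose[OF lim Suc_top] upper] by simp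
    show "eventually (\<lambda>n. a ((?s n)\<^sup>2) / real ((?s n)\<^sup>2) * (real ((?s n)\<^sup>2) / real n)
        \<le> a n / real n) sequentially"
      using eventually_gt_at_top[of 0]
    proof eventually_elim
      case (elim n)
      have "a ((?s n)\<^sup>2) \<le> a n" by (rule monoD[OF \<open>mono a\<close>]) simp
      with elim show ?case by (simp add: divide_right_mono)
    qed
    show "eventually (\<lambda>n. a n / real n
        \<le> a ((Suc (?s n))\<^sup>2) / real ((Suc (?s n))\<^sup>2) * (real ((Suc (?s n))\<^sup>2) / real n)) sequentially"
      using eventually_gt_at_top[of 0]
    proof eventually_elim
      case (elim n)
      have "a n \<le> a ((Suc (?s n))\<^sup>2)"
        by (intro monoD[OF \<open>mono a\<close>] less_imp_le Suc_floor_sqrt_power2_gt)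
      moreover have "real ((Suc (?s n))\<^sup>2) \<noteq> 0" by simp
      ultimately show ?case by (simp add: divide_right_mono del: of_nat_power of_nat_Suc)
    qed
  qed
qed

text \<open>
  By monotone convergence the random series of squares has a finite expectation, hence is almost
  surely finite, so that its terms tend to \<open>0\<close>.
\<close>

lemma AE_tendsto_0_of_summable_squares:
  fixes Y :: "nat \<Rightarrow> 'a \<Rightarrow> real"
  assumes int: "\<And>l. integrable M (\<lambda>x. (Y l x)\<^sup>2)"
    and sum: "summable (\<lambda>l. \<integral>x. (Y l x)\<^sup>2 \<partial>M)"
  shows "AE x in M. (\<lambda>l. Y l x) \<longlonglongrightarrow> 0"
proof -
  have [measurable]: "(\<lambda>x. (Y l x)\<^sup>2) \<in> borel_measurable M" for l
    using int by blast
  have "(\<integral>\<^sup>+x. (\<Sum>l. ennreal ((Y l x)\<^sup>2)) \<partial>M) = (\<Sum>l. \<integral>\<^sup>+x. ennreal ((Y l x)\<^sup>2) \<partial>M)"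
    by (rule nn_integral_suminf) simp
  also have "\<dots> = (\<Sum>l. ennreal (\<integral>x. (Y l x)\<^sup>2 \<partial>M))"
    by (intro suminf_cong nn_integral_eq_integral int) simp
  also have "\<dots> = ennreal (\<Sum>l. \<integral>x. (Y l x)\<^sup>2 \<partial>M)"
    by (intro suminf_ennreal2 sum) simp
  finally have "(\<integral>\<^sup>+x. (\<Sum>l. ennreal ((Y l x)\<^sup>2)) \<partial>M) \<noteq> \<infinity>" by simp
  then have "AE x in M. (\<Sum>l. ennreal ((Y l x)\<^sup>2)) \<noteq> \<infinity>"
    by (intro nn_integral_PInf_AE) simp_all
  then show ?thesis
  proof eventually_elim
    case (elim x)
    then have "summable (\<lambda>l. (Y l x)\<^sup>2)"
      by (intro summable_suminf_not_top) simp_all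
    then have "(\<lambda>l. (Y l x)\<^sup>2) \<longlonglongrightarrow> 0" by (rule summable_LIMSEQ_zero)
    then show ?case by simp
  qed
qed

text \<open>
  Linear growth of the variance is too weak for a Borel-Cantelli argument along all \<open>n\<close>, but it
  suffices along \<open>n = l\<^sup>2\<close>, where the normalized variances are at most \<open>C / l\<^sup>2\<close>; monotonicity in \<open>n\<close>
  takes care of the remaining indices.
\<close>

lemma (in prob_space) strong_law_mono:
  fixes L :: "nat \<Rightarrow> 'a \<Rightarrow> real"
  assumes mono: "AE x in M. mono (\<lambda>n. L n x)"
    and int: "\<And>n. integrable M (L n)"
    and int2: "\<And>n. integrable M (\<lambda>x. (L n x)\<^sup>2)"
    and var: "\<And>n. variance (L n) \<le> C * real n"
    and mean: "(\<lambda>n. expectation (L n) / real n) \<longlonglongrightarrow> \<alpha>"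
  shows "AE x in M. (\<lambda>n. L n x / real n) \<longlonglongrightarrow> \<alpha>"
proof -
  let ?Y = "\<lambda>l x. (L (l\<^sup>2) x - expectation (L (l\<^sup>2))) / real (l\<^sup>2)"
  have "AE x in M. (\<lambda>l. ?Y l x) \<longlonglongrightarrow> 0"
  proof (rule AE_tendsto_0_of_summable_squares)
    show int_Y: "integrable M (\<lambda>x. (?Y l x)\<^sup>2)" for l
      using int int2 by (simp add: power_divide power2_diff)
    have le: "(\<integral>x. (?Y l x)\<^sup>2 \<partial>M) \<le> C * (1 / real l ^ 2)" for l
    proof (cases "l = 0")
      case False
      have "(\<integral>x. (?Y l x)\<^sup>2 \<partial>M) = variance (L (l\<^sup>2)) / (real (l\<^sup>2))\<^sup>2"
        by (simp add: power_divide)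
      also have "\<dots> \<le> C * real (l\<^sup>2) / (real (l\<^sup>2))\<^sup>2"
        by (intro divide_right_mono var) simp
      also have "\<dots> = C * (1 / real l ^ 2)"
        using False by (simp add: power2_eq_square)
      finally show ?thesis .
    qed simp
    show "summable (\<lambda>l. \<integral>x. (?Y l x)\<^sup>2 \<partial>M)"
    proof (rule summable_comparison_test')
      show "summable (\<lambda>l. C * (1 / real l ^ 2))"
        using inverse_power_summable[of 2, where ?'a = real]
        by (intro summable_mult) (simp add: inverse_eq_divide)
      show "norm (\<integral>x. (?Y l x)\<^sup>2 \<partial>M) \<le> C * (1 / real l ^ 2)" for l
        using le[of l] by (simp add: integral_nonneg_AE)
    qed
  qed
  with mono show ?thesis
  proof eventually_elim
    case (elim x)
    have sq: "filterlim (\<lambda>l::nat. l\<^sup>2) at_top sequentially" by real_asymp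
    have "(\<lambda>l. ?Y l x + expectation (L (l\<^sup>2)) / real (l\<^sup>2)) \<longlonglongrightarrow> 0 + \<alpha>"
      by (rule tendsto_add[OF elim(2) filterlim_compose[OF mean sq]])
    then have "(\<lambda>l. L (l\<^sup>2) x / real (l\<^sup>2)) \<longlonglongrightarrow> \<alpha>"
      by (simp add: diff_divide_distrib)
    with elim(1) show ?case by (rule mono_limit_along_squares)
  qed
qed

section \<open>Variance and independence\<close>

text \<open>
  After centring, the mixed terms of the squared sum have expectation zero; a variance is at most
  the second moment.
\<close>

lemma (in prob_space) variance_sum_indep_le:
  fixes X :: "'i \<Rightarrow> 'a \<Rightarrow> real"
  assumes "finite I" and indep: "indep_vars (\<lambda>_. borel) X I"
    and int: "\<And>i. i \<in> I \<Longrightarrow> integrable M (X i)"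
    and int2: "\<And>i. i \<in> I \<Longrightarrow> integrable M (\<lambda>x. (X i x)\<^sup>2)"
  shows "variance (\<lambda>x. \<Sum>i\<in>I. X i x) \<le> (\<Sum>i\<in>I. expectation (\<lambda>x. (X i x)\<^sup>2))"
proof -
  define Y where "Y i x = X i x - expectation (X i)" for i x
  have int_Y: "integrable M (Y i)" and mean_Y: "expectation (Y i) = 0" if "i \<in> I" for i
    using int[OF that] by (simp_all add: Y_def[abs_def] prob_space)
  have indep_Y: "indep_vars (\<lambda>_. borel) Y I"
    unfolding Y_def by (rule indep_vars_compose2[OF indep]) simp
  have off: "integrable M (\<lambda>x. Y i x * Y j x)" "expectation (\<lambda>x. Y i x * Y j x) = 0"
    if "i \<in> I" "j \<in> I" "i \<noteq> j" for i j
  proof -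
    have ind: "indep_vars (\<lambda>_. borel) Y {i, j}"
      by (rule indep_vars_subset[OF indep_Y]) (use that in auto)
    show "integrable M (\<lambda>x. Y i x * Y j x)"
      using indep_vars_integrable[OF _ ind] int_Y that by auto
    show "expectation (\<lambda>x. Y i x * Y j x) = 0"
      using indep_vars_lebesgue_integral[OF _ ind] int_Y mean_Y that by auto
  qed
  have diag: "integrable M (\<lambda>x. Y i x * Y i x)"
    "expectation (\<lambda>x. Y i x * Y i x) \<le> expectation (\<lambda>x. (X i x)\<^sup>2)" if "i \<in> I" for i
  proof -
    show "integrable M (\<lambda>x. Y i x * Y i x)"
      using int[OF that] int2[OF that]
      by (simp add: Y_def power2_diff flip: power2_eq_square)
    have "expectation (\<lambda>x. Y i x * Y i x) = variance (X i)"
      by (simp add: Y_def power2_eq_square)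
    also have "\<dots> = expectation (\<lambda>x. (X i x)\<^sup>2) - (expectation (X i))\<^sup>2"
      by (rule variance_eq[OF int[OF that] int2[OF that]])
    finally show "expectation (\<lambda>x. Y i x * Y i x) \<le> expectation (\<lambda>x. (X i x)\<^sup>2)" by simp
  qed
  have int_YY: "integrable M (\<lambda>x. Y i x * Y j x)" if "i \<in> I" "j \<in> I" for i j
    using off diag that by (cases "i = j") auto
  have "variance (\<lambda>x. \<Sum>i\<in>I. X i x) = expectation (\<lambda>x. \<Sum>i\<in>I. \<Sum>j\<in>I. Y i x * Y j x)"
    using int by (simp add: Y_def sum_subtractf power2_eq_square flip: sum_product)
  also have "\<dots> = (\<Sum>i\<in>I. \<Sum>j\<in>I. expectation (\<lambda>x. Y i x * Y j x))"
    by (simp add: int_YY)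
  also have "\<dots> = (\<Sum>i\<in>I. \<Sum>j\<in>I. if i = j then expectation (\<lambda>x. Y i x * Y j x) else 0)"
    by (intro sum.cong refl) (simp add: off)
  also have "\<dots> = (\<Sum>i\<in>I. expectation (\<lambda>x. Y i x * Y i x))"
    using \<open>finite I\<close> by simp
  also have "\<dots> \<le> (\<Sum>i\<in>I. expectation (\<lambda>x. (X i x)\<^sup>2))"
    by (intro sum_mono diag)
  finally show ?thesis .
qed

lemma indep_vars_PiM_coordinates:
  assumes prob: "\<And>i. i \<in> I \<Longrightarrow> prob_space (M i)" and "J \<subseteq> I"
  shows "prob_space.indep_vars (PiM I M) M (\<lambda>i \<omega>. \<omega> i) J"
proof -
  interpret P: prob_space "PiM I M" by (intro prob_space_PiM prob)
  have "P.indep_vars M (\<lambda>i \<omega>. \<omega> i) I"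
  proof (cases "I = {}")
    case True
    then show ?thesis unfolding P.indep_vars_def P.indep_sets_def by auto
  next
    case False
    have "distr (PiM I M) (PiM I M) (\<lambda>\<omega>. \<lambda>i\<in>I. \<omega> i) = distr (PiM I M) (PiM I M) (\<lambda>\<omega>. \<omega>)"
      by (rule distr_cong) (auto simp: space_PiM PiE_restrict)
    also have "\<dots> = PiM I M" by simp
    also have "\<dots> = PiM I (\<lambda>i. distr (PiM I M) (M i) (\<lambda>\<omega>. \<omega> i))"
      by (intro PiM_cong refl distr_PiM_component[symmetric] prob)
    finally show ?thesis
      using False by (subst P.indep_vars_iff_distr_eq_PiM') auto
  qed
  then show ?thesis by (rule P.indep_vars_subset) fact
qed

section \<open>Counting chains by their length\<close>

text \<open>
  For a head \<open>i \<le> n\<close> this is the number of elements of \<open>{i, i q, i q\<^sup>2, \<dots>}\<close> that are at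
  most \<open>n\<close>.  The formula repeats the length of \<open>telescopic_subword\<close>.
\<close>

definition chain_length :: "nat \<Rightarrow> nat \<Rightarrow> nat \<Rightarrow> nat" where
  "chain_length q n i = Suc (GREATEST r. i * q ^ r \<le> n)"

definition heads_upto :: "nat \<Rightarrow> nat \<Rightarrow> nat set" where
  "heads_upto q n = {i \<in> index_heads q. i \<le> n}"

lemma finite_heads_upto [simp]: "finite (heads_upto q n)"
  by (rule finite_subset[of _ "{..n}"]) (auto simp: heads_upto_def)

lemma less_chain_length_iff:
  assumes q: "2 \<le> q" and i: "i \<in> heads_upto q n"
  shows "j < chain_length q n i \<longleftrightarrow> i * q ^ j \<le> n"
proof -
  let ?r = "GREATEST r. i * q ^ r \<le> n"
  have pos: "1 \<le> i" and "i \<le> n" using i by (auto simp: heads_upto_def index_heads_def)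
  have bound: "r \<le> n" if "i * q ^ r \<le> n" for r
  proof -
    have "r < q ^ r" using q by (simp add: power_gt_expt)
    also have "q ^ r \<le> i * q ^ r" using pos by simp
    finally show ?thesis using that by simp
  qed
  have r: "i * q ^ ?r \<le> n"
    by (rule GreatestI_nat[where k = 0 and b = n]) (use bound \<open>i \<le> n\<close> in auto)
  have "j \<le> ?r" if "i * q ^ j \<le> n"
    by (rule Greatest_le_nat[where b = n]) (use bound that in auto)
  moreover have "i * q ^ j \<le> n" if "j \<le> ?r"
  proof -
    have "i * q ^ j \<le> i * q ^ ?r" using that q by (intro mult_left_mono power_increasing) auto
    with r show ?thesis by (rule le_trans[rotated])
  qed
  ultimately show ?thesis by (auto simp: chain_length_def less_Suc_eq_le)
qed

definition chain_count :: "nat \<Rightarrow> nat \<Rightarrow> nat \<Rightarrow> nat" where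
  "chain_count q n j = card {i \<in> heads_upto q n. chain_length q n i = Suc j}"

text \<open>
  The heads are what remains of \<open>{1..x}\<close> when the \<open>x div q\<close> multiples of \<open>q\<close> are removed.
\<close>

lemma card_heads_upto:
  assumes "2 \<le> q"
  shows "card (heads_upto q x) = x - x div q"
proof -
  have eq: "heads_upto q x = {1..x} - (*) q ` {1..x div q}"
  proof (intro set_eqI iffI)
    fix i assume "i \<in> heads_upto q x"
    then show "i \<in> {1..x} - (*) q ` {1..x div q}"
      by (auto simp: heads_upto_def index_heads_def)
  next
    fix i assume i: "i \<in> {1..x} - (*) q ` {1..x div q}"
    have "\<not> q dvd i"
    proof
      assume "q dvd i"
      then obtain k where k: "i = q * k" by auto
      with i assms have "k \<in> {1..x div q}"
        by (auto simp: less_eq_div_iff_mult_less_eq mult.commute)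
      with k i show False by auto
    qed
    with i show "i \<in> heads_upto q x" by (auto simp: heads_upto_def index_heads_def)
  qed
  have sub: "(*) q ` {1..x div q} \<subseteq> {1..x}"
  proof
    fix i assume "i \<in> (*) q ` {1..x div q}"
    then obtain k where "k \<in> {1..x div q}" "i = q * k" by blast
    with assms show "i \<in> {1..x}"
      by (auto simp: less_eq_div_iff_mult_less_eq mult.commute)
  qed
  have "card ((*) q ` {1..x div q}) = x div q"
    using assms by (subst card_image) (auto simp: inj_on_def)
  with sub show ?thesis unfolding eq by (subst card_Diff_subset) auto
qed

text \<open>
  The chain of a head \<open>i\<close> has more than \<open>j\<close> elements up to \<open>n\<close> exactly when
  \<open>i \<le> n div q ^ j\<close>.  So the heads in question are those in an interval between two such bounds,
  and counting heads up to each bound gives a second difference of \<open>n div q ^ j\<close>.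
\<close>

lemma chain_count_eq:
  assumes q: "2 \<le> q"
  shows "real (chain_count q n j) =
    real (n div q ^ j) - 2 * real (n div q ^ Suc j) + real (n div q ^ Suc (Suc j))"
proof -
  have *: "{i \<in> heads_upto q n. chain_length q n i = Suc j}
      = heads_upto q (n div q ^ j) - heads_upto q (n div q ^ Suc j)"
  proof (intro set_eqI)
    fix i
    have "chain_length q n i = Suc j \<longleftrightarrow> i * q ^ j \<le> n \<and> \<not> i * q ^ Suc j \<le> n"
      if "i \<in> heads_upto q n"
      unfolding less_chain_length_iff[OF q that, symmetric] by linarith
    moreover have "i \<le> n div q ^ k \<longleftrightarrow> i * q ^ k \<le> n" for k
      using q by (intro less_eq_div_iff_mult_less_eq) auto
    moreover have "i \<le> n" if "i * q ^ j \<le> n"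
    proof -
      have "i \<le> i * q ^ j" using q by simp
      with that show ?thesis by (rule le_trans[rotated])
    qed
    ultimately show "i \<in> {i \<in> heads_upto q n. chain_length q n i = Suc j} \<longleftrightarrow>
        i \<in> heads_upto q (n div q ^ j) - heads_upto q (n div q ^ Suc j)"
      unfolding heads_upto_def by (simp del: power_Suc) blast
  qed
  have div: "n div q ^ k div q = n div q ^ Suc k" for k
    by (simp add: mult.commute flip: div_mult2_eq)
  have le: "n div q ^ Suc k \<le> n div q ^ k" for k
    unfolding div[symmetric] by (rule div_le_dividend)
  have sub: "heads_upto q (n div q ^ Suc j) \<subseteq> heads_upto q (n div q ^ j)"
    using le[of j] by (auto simp: heads_upto_def)
  have "chain_count q n j = card (heads_upto q (n div q ^ j)) - card (heads_upto q (n div q ^ Suc j))"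
    unfolding chain_count_def * by (rule card_Diff_subset[OF _ sub]) simp
  also have "real \<dots> = real (card (heads_upto q (n div q ^ j))) - real (card (heads_upto q (n div q ^ Suc j)))"
    by (intro of_nat_diff card_mono sub) simp
  also have "\<dots> = real (n div q ^ j) - 2 * real (n div q ^ Suc j) + real (n div q ^ Suc (Suc j))"
    unfolding card_heads_upto[OF q] div using le[of j] le[of "Suc j"] by (simp add: of_nat_diff del: power_Suc)
  finally show ?thesis .
qed

lemma chain_count_le:
  assumes "2 \<le> q"
  shows "real (chain_count q n j) \<le> real n / real q ^ j"
proof -
  have "n div q ^ Suc (Suc j) \<le> n div q ^ Suc j"
    using assms by (intro div_le_mono2) auto
  then have "real (n div q ^ Suc (Suc j)) \<le> 2 * real (n div q ^ Suc j)" by linarith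
  then have "real (chain_count q n j) \<le> real (n div q ^ j)"
    unfolding chain_count_eq[OF assms] by linarith
  also have "\<dots> \<le> real n / real (q ^ j)" by (rule of_nat_div_le_of_nat)
  finally show ?thesis by simp
qed

lemma tendsto_div_over_self:
  assumes "0 < c"
  shows "(\<lambda>n. real (n div c) / real n) \<longlonglongrightarrow> 1 / real c"
proof (rule tendsto_sandwich[OF _ _ _ tendsto_const])
  show "(\<lambda>n. 1 / real c - 1 / real n) \<longlonglongrightarrow> 1 / real c" by real_asymp
  show "eventually (\<lambda>n. 1 / real c - 1 / real n \<le> real (n div c) / real n) sequentially"
    using eventually_gt_at_top[of 0]
  proof eventually_elim
    case (elim n)
    have "real n / real c < of_int \<lfloor>real n / real c\<rfloor> + 1"
      by (rule floor_correct[THEN conjunct2, unfolded of_int_add of_int_1])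
    then have "real n / real c \<le> real (n div c) + 1" by (simp add: floor_divide_of_nat_eq)
    with elim have "(real n / real c - 1) / real n \<le> real (n div c) / real n"
      by (intro divide_right_mono) auto
    with elim show ?case by (simp add: diff_divide_distrib)
  qed
  show "eventually (\<lambda>n. real (n div c) / real n \<le> 1 / real c) sequentially"
    using eventually_gt_at_top[of 0]
  proof eventually_elim
    case (elim n)
    have "real (n div c) / real n \<le> (real n / real c) / real n"
      by (intro divide_right_mono of_nat_div_le_of_nat) simp
    with elim show ?case by simp
  qed
qed

lemma tendsto_chain_count:
  assumes q: "2 \<le> q"
  shows "(\<lambda>n. real (chain_count q n j) / real n) \<longlonglongrightarrow> (real q - 1)\<^sup>2 / real q ^ (j + 2)"
proof -
  have "(\<lambda>n. real (n div q ^ j) / real n - 2 * (real (n div q ^ Suc j) / real n)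
      + real (n div q ^ Suc (Suc j)) / real n)
    \<longlonglongrightarrow> 1 / real (q ^ j) - 2 * (1 / real (q ^ Suc j)) + 1 / real (q ^ Suc (Suc j))"
    using q by (intro tendsto_intros tendsto_div_over_self) auto
  also have "1 / real (q ^ j) - 2 * (1 / real (q ^ Suc j)) + 1 / real (q ^ Suc (Suc j))
      = (real q - 1)\<^sup>2 / real q ^ (j + 2)"
    using q by (simp add: field_simps power2_eq_square)
  finally show ?thesis
    unfolding chain_count_eq[OF q] by (simp add: add_divide_distrib diff_divide_distrib)
qed

text \<open>
  The sum over heads is grouped by chain length and written as an infinite series (with finitely
  many nonzero terms), the form in which Tannery's theorem applies.
\<close>

lemma sums_over_chain_lengths:
  fixes h :: "nat \<Rightarrow> real"
  assumes q: "2 \<le> q"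
  shows "(\<lambda>j. real (chain_count q n j) * h (Suc j)) sums (\<Sum>i\<in>heads_upto q n. h (chain_length q n i))"
proof -
  \<comment> \<open>A chain reaching \<open>i * q ^ j \<le> n\<close> has \<open>j < q ^ j \<le> n\<close>.\<close>
  have ran: "chain_length q n ` heads_upto q n \<subseteq> Suc ` {..n}"
  proof
    fix k assume "k \<in> chain_length q n ` heads_upto q n"
    then obtain i where i: "i \<in> heads_upto q n" and k: "k = chain_length q n i" by auto
    obtain j where j: "k = Suc j" unfolding k chain_length_def by blast
    with less_chain_length_iff[OF q i, of j] have "i * q ^ j \<le> n" unfolding k[symmetric] by simp
    moreover have "j < q ^ j" using q by (simp add: power_gt_expt)
    moreover have "q ^ j \<le> i * q ^ j" using i by (auto simp: heads_upto_def index_heads_def)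
    ultimately have "j \<le> n" by linarith
    then show "k \<in> Suc ` {..n}" unfolding j by simp
  qed
  have "(\<Sum>i\<in>heads_upto q n. h (chain_length q n i))
      = (\<Sum>k\<in>Suc ` {..n}. \<Sum>i\<in>{i \<in> heads_upto q n. chain_length q n i = k}. h (chain_length q n i))"
    by (rule sum.group[symmetric]) (use ran in auto)
  also have "\<dots> = (\<Sum>j\<le>n. real (chain_count q n j) * h (Suc j))"
    by (subst sum.reindex) (auto simp: chain_count_def)
  also have "(\<lambda>j. real (chain_count q n j) * h (Suc j)) sums \<dots>"
  proof (rule sums_finite)
    fix j assume "j \<notin> {..n}"
    then have "{i \<in> heads_upto q n. chain_length q n i = Suc j} = {}" using ran by auto
    then show "real (chain_count q n j) * h (Suc j) = 0" unfolding chain_count_def by simp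
  qed simp
  finally show ?thesis .
qed

lemma sum_over_heads_le:
  fixes h :: "nat \<Rightarrow> real"
  assumes q: "2 \<le> q" and nonneg: "\<And>k. 0 \<le> h k"
    and summable: "summable (\<lambda>j. h (Suc j) / real q ^ j)"
  shows "(\<Sum>i\<in>heads_upto q n. h (chain_length q n i)) \<le> (\<Sum>j. h (Suc j) / real q ^ j) * real n"
proof -
  have "(\<lambda>j. h (Suc j) / real q ^ j * real n) sums ((\<Sum>j. h (Suc j) / real q ^ j) * real n)"
    by (intro sums_mult2 summable_sums summable)
  with sums_over_chain_lengths[OF q, of n h] show ?thesis
  proof (rule sums_le[rotated 1])
    show "real (chain_count q n j) * h (Suc j) \<le> h (Suc j) / real q ^ j * real n" for j
      using mult_right_mono[OF chain_count_le[OF q] nonneg, of n j "Suc j"] by (simp add: mult.commute)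
  qed
qed

text \<open>
  The frequency of each chain length converges, and the frequency of length \<open>j + 1\<close> never exceeds
  \<open>q ^ - j\<close>; this domination lets Tannery's theorem exchange limit and sum.
\<close>

lemma tendsto_average_over_heads:
  fixes h :: "nat \<Rightarrow> real"
  assumes q: "2 \<le> q" and summable: "summable (\<lambda>j. \<bar>h (Suc j)\<bar> / real q ^ j)"
  shows "(\<lambda>n. (\<Sum>i\<in>heads_upto q n. h (chain_length q n i)) / real n)
    \<longlonglongrightarrow> (\<Sum>j. (real q - 1)\<^sup>2 / real q ^ (j + 2) * h (Suc j))"
proof -
  have "((\<lambda>n. \<Sum>j. real (chain_count q n j) / real n * h (Suc j))
    \<longlongrightarrow> (\<Sum>j. (real q - 1)\<^sup>2 / real q ^ (j + 2) * h (Suc j))) sequentially"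
  proof (rule tannerys_theorem[THEN conjunct2, THEN conjunct2])
    show "((\<lambda>n. real (chain_count q n j) / real n * h (Suc j))
        \<longlongrightarrow> (real q - 1)\<^sup>2 / real q ^ (j + 2) * h (Suc j)) sequentially" for j
      by (intro tendsto_mult tendsto_chain_count[OF q] tendsto_const)
    have "norm (real (chain_count q n j) / real n * h (Suc j)) \<le> \<bar>h (Suc j)\<bar> / real q ^ j" for n j
    proof -
      have "real (chain_count q n j) / real n \<le> 1 / real q ^ j"
      proof (cases "n = 0")
        case False
        then show ?thesis
          using divide_right_mono[OF chain_count_le[OF q, of n j], of "real n"] by simp
      qed simp
      from mult_right_mono[OF this, of "\<bar>h (Suc j)\<bar>"] show ?thesis by (simp add: abs_mult)
    qed
    then show "eventually (\<lambda>(j, n). norm (real (chain_count q n j) / real n * h (Suc j))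
        \<le> \<bar>h (Suc j)\<bar> / real q ^ j) (sequentially \<times>\<^sub>F sequentially)"
      by (intro always_eventually) auto
  qed (use summable in auto)
  moreover have "(\<Sum>j. real (chain_count q n j) / real n * h (Suc j))
      = (\<Sum>i\<in>heads_upto q n. h (chain_length q n i)) / real n" for n
    using sums_divide[OF sums_over_chain_lengths[OF q, of n h], of "real n"]
    by (simp add: sums_iff)
  ultimately show ?thesis by simp
qed

section \<open>Information of initial words\<close>

text \<open>
  The information function of the partition into cylinders of length \<open>k\<close>; its expectation is the
  entropy \<open>block_entropy\<close>.
\<close>

definition block_information :: "nat \<Rightarrow> (nat \<Rightarrow> nat) measure \<Rightarrow> nat \<Rightarrow> (nat \<Rightarrow> nat) \<Rightarrow> real" where
  "block_information m \<mu> k x = - ln (measure \<mu> (cylinder m (initial_word x k)))"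

lemma length_initial_word [simp]: "length (initial_word x n) = n"
  by (simp add: initial_word_def)

lemma nth_initial_word: "j < n \<Longrightarrow> initial_word x n ! j = x (Suc j)"
  by (simp add: initial_word_def del: upt_Suc)

lemma initial_word_in_words:
  assumes "x \<in> space (seq_space m)"
  shows "initial_word x n \<in> words m n"
  using assms by (auto simp: words_def initial_word_def seq_space_def space_PiM PiE_iff)

lemma in_cylinder_iff:
  assumes "x \<in> space (seq_space m)"
  shows "x \<in> cylinder m u \<longleftrightarrow> initial_word x (length u) = u"
  using assms by (auto simp: cylinder_def list_eq_iff_nth_eq nth_initial_word)

lemma finite_words [simp]: "finite (words m k)"
  using finite_lists_length_eq[of "{..<m}" k] by (simp add: words_def conj_commute)

lemma card_words: "card (words m k) = m ^ k"
  using card_lists_length_eq[of "{..<m}" k] by (simp add: words_def conj_commute)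

lemma initial_word_measurable:
  "(\<lambda>x. initial_word x k) \<in> measurable (seq_space m) (count_space (words m k))"
proof -
  have "(\<lambda>x. initial_word x k) -` {u} \<inter> space (seq_space m) = cylinder m u" if "u \<in> words m k" for u
    using that in_cylinder_iff[of _ m u] by (auto simp: words_def cylinder_def)
  then show ?thesis
    by (subst measurable_count_space_eq2) (auto simp: initial_word_in_words cylinder_measurable)
qed

lemma block_function_measurable [measurable]:
  "(\<lambda>x. g (initial_word x k)) \<in> borel_measurable (seq_space m)"
  by (rule measurable_compose[OF initial_word_measurable]) simp

text \<open>
  The following facts are applied both to \<open>\<mu>\<close> and to its telescopic product measure.
\<close>

locale seq_prob_space = prob_space \<mu> for \<mu> :: "(nat \<Rightarrow> nat) measure" +
  fixes m :: nat
  assumes sets_eq: "sets \<mu> = sets (seq_space m)"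
begin

lemma space_eq: "space \<mu> = space (seq_space m)"
  by (rule sets_eq_imp_space_eq[OF sets_eq])

lemma
  fixes g :: "nat list \<Rightarrow> real"
  shows integrable_block_function: "integrable \<mu> (\<lambda>x. g (initial_word x k))" (is ?int)
    and expectation_block_function:
      "expectation (\<lambda>x. g (initial_word x k)) = (\<Sum>u\<in>words m k. prob (cylinder m u) * g u)" (is ?eq)
proof -
  let ?F = "\<lambda>x. \<Sum>u\<in>words m k. indicator (cylinder m u) x * g u"
  have F: "g (initial_word x k) = ?F x" if "x \<in> space \<mu>" for x
  proof -
    have x: "x \<in> space (seq_space m)" using that by (simp add: space_eq)
    have "?F x = (\<Sum>u\<in>words m k. if u = initial_word x k then g u else 0)"
      by (intro sum.cong refl) (auto simp: in_cylinder_iff[OF x] words_def indicator_def)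
    then show ?thesis using initial_word_in_words[OF x, of k] by simp
  qed
  have cyl: "cylinder m u \<in> sets \<mu>" for u by (simp add: sets_eq cylinder_measurable)
  have int: "integrable \<mu> (\<lambda>x. indicator (cylinder m u) x * g u)" for u
    using cyl[of u] by (intro integrable_mult_left integrable_real_indicator) (simp_all add: less_top[symmetric])
  have "integrable \<mu> ?F" by (intro Bochner_Integration.integrable_sum int)
  then show ?int
    using Bochner_Integration.integrable_cong[of \<mu> \<mu> "\<lambda>x. g (initial_word x k)" ?F, OF refl F] by blast
  have "expectation (\<lambda>x. g (initial_word x k)) = expectation ?F"
    by (rule Bochner_Integration.integral_cong[OF refl F])
  also have "\<dots> = (\<Sum>u\<in>words m k. expectation (\<lambda>x. indicator (cylinder m u) x * g u))"
    by (rule Bochner_Integration.integral_sum[OF int])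
  also have "\<dots> = (\<Sum>u\<in>words m k. prob (cylinder m u) * g u)"
    by (intro sum.cong refl) (simp add: cyl)
  finally show ?eq .
qed

lemma sum_prob_cylinders: "(\<Sum>u\<in>words m k. prob (cylinder m u)) = 1"
  using expectation_block_function[of "\<lambda>_. 1" k] by (simp add: prob_space)

lemma expectation_block_information:
  "expectation (block_information m \<mu> k) = block_entropy m \<mu> k"
  using expectation_block_function[of "\<lambda>u. - ln (prob (cylinder m u))" k]
  by (simp add: block_information_def[abs_def] block_entropy_def sum_negf)

text \<open>
  For each length there are only finitely many cylinders, so those of measure zero together form a
  null set, and there are countably many lengths.
\<close>

lemma AE_cylinders_positive:
  "AE x in \<mu>. \<forall>n. 0 < prob (cylinder m (initial_word x n))"
proof -
  have "AE x in \<mu>. 0 < prob (cylinder m (initial_word x n))" for n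
  proof -
    have "AE x in \<mu>. \<forall>u\<in>words m n. prob (cylinder m u) = 0 \<longrightarrow> x \<notin> cylinder m u"
    proof (rule AE_finite_allI)
      fix u
      have "cylinder m u \<in> sets \<mu>" by (simp add: sets_eq cylinder_measurable)
      then show "AE x in \<mu>. prob (cylinder m u) = 0 \<longrightarrow> x \<notin> cylinder m u"
        by (cases "prob (cylinder m u) = 0")
           (auto intro!: AE_not_in simp: null_sets_def emeasure_eq_measure)
    qed simp
    with AE_space show ?thesis
    proof eventually_elim
      case (elim x)
      then have x: "x \<in> space (seq_space m)" by (simp add: space_eq)
      then have "x \<in> cylinder m (initial_word x n)" by (simp add: in_cylinder_iff)
      with elim(2) initial_word_in_words[OF x, of n] have "prob (cylinder m (initial_word x n)) \<noteq> 0"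
        by blast
      then show ?case using measure_nonneg[of \<mu> "cylinder m (initial_word x n)"] by linarith
    qed
  qed
  then show ?thesis by (simp add: AE_all_countable)
qed

lemma mono_block_information:
  assumes "\<forall>n. 0 < prob (cylinder m (initial_word x n))"
  shows "mono (\<lambda>n. block_information m \<mu> n x)"
proof (rule monoI)
  fix k n :: nat assume "k \<le> n"
  then have "cylinder m (initial_word x n) \<subseteq> cylinder m (initial_word x k)"
    by (auto simp: cylinder_def nth_initial_word)
  then have "prob (cylinder m (initial_word x n)) \<le> prob (cylinder m (initial_word x k))"
    by (rule finite_measure_mono) (simp add: sets_eq cylinder_measurable)
  with assms show "block_information m \<mu> k x \<le> block_information m \<mu> n x"
    by (simp add: block_information_def)
qed

end

section \<open>Growth of the second moments\<close>

text \<open>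
  Splitting at the level \<open>p = exp (- 2 s)\<close>: above it \<open>\<bar>ln p\<bar> \<le> 2 s\<close>, and below it \<open>p (ln p)\<^sup>2\<close>
  is at most \<open>8 sqrt p \<le> 8 exp (- s)\<close>.
\<close>

lemma mult_ln_squared_le:
  fixes p :: real
  assumes "0 \<le> p" "p \<le> 1" "0 \<le> s"
  shows "p * (ln p)\<^sup>2 \<le> 8 * exp (- s) + p * (2 * s)\<^sup>2"
proof (cases "p = 0")
  case False
  define t where "t = - ln p"
  have t: "0 \<le> t" "p = exp (- t)" using assms False by (auto simp: t_def)
  show ?thesis
  proof (cases "t \<le> 2 * s")
    case True
    then have "t\<^sup>2 \<le> (2 * s)\<^sup>2" using t by (intro power_mono) auto
    then have "p * (ln p)\<^sup>2 \<le> p * (2 * s)\<^sup>2"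
      using assms by (intro mult_left_mono) (simp_all add: t_def)
    then show ?thesis using exp_ge_zero[of "- s"] by linarith
  next
    case False
    have "1 + t / 2 + (t / 2)\<^sup>2 / 2 \<le> exp (t / 2)"
      using t by (intro exp_lower_Taylor_quadratic) simp
    then have "t\<^sup>2 \<le> 8 * exp (t / 2)" using t by (simp add: power_divide)
    then have "p * (ln p)\<^sup>2 \<le> exp (- t) * (8 * exp (t / 2))"
      unfolding t(2) by (intro mult_left_mono) simp_all
    also have "\<dots> = 8 * exp (- (t / 2))" by (simp flip: exp_add)
    also have "\<dots> \<le> 8 * exp (- s)" using False by simp
    finally show ?thesis using assms by (simp add: add_increasing2)
  qed
qed simp

text \<open>
  Apply the preceding inequality with \<open>exp s = m ^ k\<close>, the number of words of length \<open>k\<close>: the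
  terms \<open>8 exp (- s)\<close> then add up to \<open>8\<close> over all words, and the other terms have total
  weight \<open>1\<close>.
\<close>

lemma (in seq_prob_space) block_information_second_moment:
  assumes "2 \<le> m"
  shows "expectation (\<lambda>x. (block_information m \<mu> k x)\<^sup>2) \<le> 8 + (2 * (real k * ln (real m)))\<^sup>2"
proof -
  let ?s = "real k * ln (real m)"
  have s: "0 \<le> ?s" "exp (- ?s) = 1 / real (m ^ k)"
    using assms by (simp_all add: exp_minus exp_of_nat_mult inverse_eq_divide)
  have "expectation (\<lambda>x. (block_information m \<mu> k x)\<^sup>2)
      = (\<Sum>u\<in>words m k. prob (cylinder m u) * (ln (prob (cylinder m u)))\<^sup>2)"
    using expectation_block_function[of "\<lambda>u. (ln (prob (cylinder m u)))\<^sup>2" k]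
    by (simp add: block_information_def)
  also have "\<dots> \<le> (\<Sum>u\<in>words m k. 8 * exp (- ?s) + prob (cylinder m u) * (2 * ?s)\<^sup>2)"
    by (intro sum_mono mult_ln_squared_le s) simp_all
  also have "\<dots> = real (card (words m k)) * (8 * exp (- ?s))
      + (\<Sum>u\<in>words m k. prob (cylinder m u)) * (2 * ?s)\<^sup>2"
    by (simp only: sum.distrib sum_constant sum_distrib_right)
  also have "\<dots> = 8 + (2 * ?s)\<^sup>2"
    unfolding s(2) card_words sum_prob_cylinders using assms by simp
  finally show ?thesis .
qed

lemma (in seq_prob_space) block_information_square_integrable:
  "integrable \<mu> (block_information m \<mu> k)" "integrable \<mu> (\<lambda>x. (block_information m \<mu> k x)\<^sup>2)"
  using integrable_block_function[of "\<lambda>u. - ln (prob (cylinder m u))" k]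
    integrable_block_function[of "\<lambda>u. (- ln (prob (cylinder m u)))\<^sup>2" k]
  by (simp_all add: block_information_def[abs_def])

lemma (in seq_prob_space) block_entropy_nonneg: "0 \<le> block_entropy m \<mu> k"
proof -
  have "0 \<le> block_information m \<mu> k x" for x
    by (cases "prob (cylinder m (initial_word x k)) = 0")
       (simp_all add: block_information_def zero_less_measure_iff)
  then show ?thesis
    unfolding expectation_block_information[symmetric]
    by (intro Bochner_Integration.integral_nonneg)
qed

lemma (in seq_prob_space) block_entropy_le_second_moment:
  "2 * block_entropy m \<mu> k \<le> 1 + expectation (\<lambda>x. (block_information m \<mu> k x)\<^sup>2)"
proof -
  have "2 * block_information m \<mu> k x \<le> 1 + (block_information m \<mu> k x)\<^sup>2" for x
    using sum_squares_bound[of 1 "block_information m \<mu> k x"] by simp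
  then have "expectation (\<lambda>x. 2 * block_information m \<mu> k x)
      \<le> expectation (\<lambda>x. 1 + (block_information m \<mu> k x)\<^sup>2)"
    by (intro integral_mono) (auto simp: block_information_square_integrable)
  then show ?thesis
    by (simp add: block_information_square_integrable expectation_block_information prob_space)
qed

text \<open>
  Quadratic growth against the geometric weights \<open>q ^ - j \<le> 2 ^ - j\<close>.
\<close>

lemma (in seq_prob_space) summable_weighted_information:
  assumes "2 \<le> m" "2 \<le> q"
  shows "summable (\<lambda>j. expectation (\<lambda>x. (block_information m \<mu> (Suc j) x)\<^sup>2) / real q ^ j)" (is "summable ?V")
    and "summable (\<lambda>j. block_entropy m \<mu> (Suc j) / real q ^ j)" (is "summable ?H")
proof -
  let ?b = "\<lambda>j. 8 * (1 / 2 ^ j) + (2 * ln (real m))\<^sup>2 * ((real j + 1)\<^sup>2 / 2 ^ j)"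
  have geom: "summable (\<lambda>j. 1 / 2 ^ j :: real)"
    using summable_geometric[of "1 / 2 :: real"] by (simp add: power_divide)
  have "summable (\<lambda>j. (real j + 1)\<^sup>2 / 2 ^ j)"
  proof (rule summable_comparison_test_bigo)
    show "summable (\<lambda>j. norm (inverse (real j ^ 2)))"
      using inverse_power_summable[of 2, where ?'a = real] by simp
    show "(\<lambda>j. (real j + 1)\<^sup>2 / 2 ^ j) \<in> O(\<lambda>j. inverse (real j ^ 2))" by real_asymp
  qed
  then have b: "summable ?b" by (rule summable_add[OF summable_mult[OF geom] summable_mult])
  have pow: "x / real q ^ j \<le> x / 2 ^ j" if "0 \<le> x" for x :: real and j
    using assms that by (intro divide_left_mono power_mono) auto
  show V: "summable ?V"
  proof (rule summable_comparison_test'[OF b])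
    fix j :: nat
    have "?V j \<le> expectation (\<lambda>x. (block_information m \<mu> (Suc j) x)\<^sup>2) / 2 ^ j"
      by (rule pow) (simp add: integral_nonneg_AE)
    also have "\<dots> \<le> (8 + (2 * (real (Suc j) * ln (real m)))\<^sup>2) / 2 ^ j"
      by (intro divide_right_mono block_information_second_moment assms) simp
    also have "\<dots> = ?b j" by (simp add: power_mult_distrib add_divide_distrib add.commute)
    finally show "norm (?V j) \<le> ?b j" by (simp add: integral_nonneg_AE)
  qed
  show "summable ?H"
  proof (rule summable_comparison_test')
    show "summable (\<lambda>j. 1 / 2 ^ j + ?V j)" by (intro summable_add geom V)
    fix j :: nat
    have "block_entropy m \<mu> (Suc j) \<le> 1 + expectation (\<lambda>x. (block_information m \<mu> (Suc j) x)\<^sup>2)"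
      using block_entropy_le_second_moment[of "Suc j"] block_entropy_nonneg[of "Suc j"] by linarith
    then have "?H j \<le> (1 + expectation (\<lambda>x. (block_information m \<mu> (Suc j) x)\<^sup>2)) / real q ^ j"
      by (intro divide_right_mono) auto
    also have "\<dots> \<le> 1 / 2 ^ j + ?V j"
      using pow[of 1 j] by (simp add: add_divide_distrib)
    finally show "norm (?H j) \<le> 1 / 2 ^ j + ?V j"
      using block_entropy_nonneg by simp
  qed
qed

section \<open>The telescopic product measure\<close>

lemma (in seq_prob_space) seq_prob_space_telescopic_measure:
  assumes "2 \<le> q"
  shows "seq_prob_space (telescopic_measure m q \<mu>) m"
  by (intro seq_prob_space.intro seq_prob_space_axioms.intro prob_space_telescopic_measure
      sets_telescopic_measure assms sets_eq prob_space_axioms)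

lemma telescopic_subword_initial_word:
  assumes q: "2 \<le> q" and i: "i \<in> heads_upto q n"
  shows "telescopic_subword q i (initial_word (telescopic_glue q \<omega>) n)
    = initial_word (\<omega> i) (chain_length q n i)"
proof (rule nth_equalityI)
  show "length (telescopic_subword q i (initial_word (telescopic_glue q \<omega>) n))
      = length (initial_word (\<omega> i) (chain_length q n i))"
    by (simp add: telescopic_subword_def chain_length_def)
  fix j assume "j < length (telescopic_subword q i (initial_word (telescopic_glue q \<omega>) n))"
  then have j: "j < chain_length q n i"
    by (simp add: telescopic_subword_def chain_length_def)
  have head: "i \<in> index_heads q" using i by (simp add: heads_upto_def)
  have le: "i * q ^ j \<le> n" using j less_chain_length_iff[OF q i] by simp
  have pos: "0 < i * q ^ j" using q head by (auto simp: index_heads_def)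
  have "telescopic_subword q i (initial_word (telescopic_glue q \<omega>) n) ! j
      = initial_word (telescopic_glue q \<omega>) n ! (i * q ^ j - 1)"
    using j by (simp add: telescopic_subword_def chain_length_def del: upt_Suc)
  also have "\<dots> = telescopic_glue q \<omega> (i * q ^ j)"
  proof -
    from le pos have "i * q ^ j - 1 < n" "Suc (i * q ^ j - 1) = i * q ^ j" by linarith+
    then show ?thesis by (simp only: nth_initial_word)
  qed
  also have "\<dots> = initial_word (\<omega> i) (chain_length q n i) ! j"
    using j by (simp add: telescopic_glue_apply[OF q head] nth_initial_word)
  finally show "telescopic_subword q i (initial_word (telescopic_glue q \<omega>) n) ! j
      = initial_word (\<omega> i) (chain_length q n i) ! j" .
qed

text \<open>
  The logarithm of the product formula for cylinders.  Positivity of the whole product makes every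
  factor nonzero, so that the logarithm may be taken factor by factor.
\<close>

lemma (in seq_prob_space) telescopic_information_eq_sum:
  assumes q: "2 \<le> q"
    and pos: "0 < measure (telescopic_measure m q \<mu>)
      (cylinder m (initial_word (telescopic_glue q \<omega>) n))"
  shows "block_information m (telescopic_measure m q \<mu>) n (telescopic_glue q \<omega>)
    = (\<Sum>i\<in>heads_upto q n. block_information m \<mu> (chain_length q n i) (\<omega> i))"
proof -
  have prod: "measure (telescopic_measure m q \<mu>) (cylinder m (initial_word (telescopic_glue q \<omega>) n))
      = (\<Prod>i\<in>heads_upto q n. prob (cylinder m (initial_word (\<omega> i) (chain_length q n i))))"
    using telescopic_measure_cylinder[OF q sets_eq prob_space_axioms,
        of "initial_word (telescopic_glue q \<omega>) n"]
    by (simp add: telescopic_subword_initial_word[OF q] flip: heads_upto_def)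
  then have "(\<Prod>i\<in>heads_upto q n. prob (cylinder m (initial_word (\<omega> i) (chain_length q n i)))) \<noteq> 0"
    using pos by linarith
  then show ?thesis
    unfolding block_information_def prod by (subst ln_prod) (auto simp: sum_negf)
qed

text \<open>
  Both integrals are pulled back along the gluing map to the product space, where almost surely the
  information is the sum of the independent variables \<open>X i\<close>.  Transferring moments instead of the
  almost sure limit leaves the strong law to be applied on the space of glued sequences itself.
\<close>

lemma (in seq_prob_space) telescopic_information_moments:
  assumes q: "2 \<le> q"
  defines "\<nu> \<equiv> telescopic_measure m q \<mu>"
  shows "integral\<^sup>L \<nu> (block_information m \<nu> n)
      = (\<Sum>i\<in>heads_upto q n. block_entropy m \<mu> (chain_length q n i))"
      (is "?E = ?S")
    and "(\<integral>x. (block_information m \<nu> n x - integral\<^sup>L \<nu> (block_information m \<nu> n))\<^sup>2 \<partial>\<nu>)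
      \<le> (\<Sum>i\<in>heads_upto q n. expectation (\<lambda>x. (block_information m \<mu> (chain_length q n i) x)\<^sup>2))"
proof -
  let ?Q = "PiM (index_heads q) (\<lambda>_. \<mu>)"
  let ?L = "block_information m \<nu> n"
  define X where "X i \<omega> = block_information m \<mu> (chain_length q n i) (\<omega> i)"
    for i and \<omega> :: "nat \<Rightarrow> nat \<Rightarrow> nat"
  interpret Q: prob_space ?Q by (intro prob_space_PiM prob_space_axioms)
  interpret N: seq_prob_space \<nu> m
    unfolding \<nu>_def by (rule seq_prob_space_telescopic_measure[OF q])
  have glue [measurable]: "telescopic_glue q \<in> measurable ?Q (seq_space m)"
    by (rule telescopic_glue_measurable[OF q sets_eq])
  have head: "i \<in> index_heads q" if "i \<in> heads_upto q n" for i
    using that by (simp add: heads_upto_def)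
  have coord: "distr ?Q \<mu> (\<lambda>\<omega>. \<omega> i) = \<mu>" if "i \<in> heads_upto q n" for i
    using distr_PiM_component[OF prob_space_axioms head[OF that]] .
  have coord_meas: "(\<lambda>\<omega>. \<omega> i) \<in> measurable ?Q \<mu>" if "i \<in> heads_upto q n" for i
    using head[OF that] by (rule measurable_component_singleton)
  have f_meas: "block_information m \<mu> k \<in> borel_measurable \<mu>" for k
    using block_information_square_integrable(1) by (rule borel_measurable_integrable)
  have f2_meas: "(\<lambda>x. (block_information m \<mu> k x)\<^sup>2) \<in> borel_measurable \<mu>" for k
    using block_information_square_integrable(2) by (rule borel_measurable_integrable)
  have X_int: "integrable ?Q (X i)" and X2_int: "integrable ?Q (\<lambda>\<omega>. (X i \<omega>)\<^sup>2)"
    and X_mean: "Q.expectation (X i) = block_entropy m \<mu> (chain_length q n i)"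
    and X_second: "Q.expectation (\<lambda>\<omega>. (X i \<omega>)\<^sup>2)
      = expectation (\<lambda>x. (block_information m \<mu> (chain_length q n i) x)\<^sup>2)"
    if "i \<in> heads_upto q n" for i
    using integrable_distr_eq[OF coord_meas[OF that] f_meas, unfolded coord[OF that]]
      integrable_distr_eq[OF coord_meas[OF that] f2_meas, unfolded coord[OF that]]
      integral_distr[OF coord_meas[OF that] f_meas, unfolded coord[OF that]]
      integral_distr[OF coord_meas[OF that] f2_meas, unfolded coord[OF that]]
    by (simp_all add: X_def[abs_def] block_information_square_integrable expectation_block_information)
  have indep: "Q.indep_vars (\<lambda>_. borel) X (heads_upto q n)"
    unfolding X_def
    by (rule Q.indep_vars_compose2[OF indep_vars_PiM_coordinates[OF prob_space_axioms]])
       (use head f_meas in auto)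
  have "AE x in \<nu>. \<forall>n. 0 < measure \<nu> (cylinder m (initial_word x n))"
    by (rule N.AE_cylinders_positive)
  then have "AE \<omega> in ?Q. \<forall>n. 0 < measure \<nu> (cylinder m (initial_word (telescopic_glue q \<omega>) n))"
    unfolding \<nu>_def telescopic_measure_def by (rule AE_distrD[OF glue])
  then have L_eq: "AE \<omega> in ?Q. ?L (telescopic_glue q \<omega>) = (\<Sum>i\<in>heads_upto q n. X i \<omega>)"
    by eventually_elim (auto simp: \<nu>_def X_def telescopic_information_eq_sum[OF q])
  have L_meas [measurable]: "?L \<in> borel_measurable (seq_space m)"
    unfolding block_information_def[abs_def]
    by (rule block_function_measurable[of "\<lambda>u. - ln (measure \<nu> (cylinder m u))"])
  have X_meas [measurable]: "X i \<in> borel_measurable ?Q" if "i \<in> heads_upto q n" for i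
    using X_int[OF that] by (rule borel_measurable_integrable)
  have mean: "?E = Q.expectation (\<lambda>\<omega>. \<Sum>i\<in>heads_upto q n. X i \<omega>)"
  proof -
    have "?E = Q.expectation (\<lambda>\<omega>. ?L (telescopic_glue q \<omega>))"
      unfolding \<nu>_def telescopic_measure_def
      by (rule integral_distr) (use L_meas in \<open>simp_all add: \<nu>_def telescopic_measure_def\<close>)
    also have "\<dots> = Q.expectation (\<lambda>\<omega>. \<Sum>i\<in>heads_upto q n. X i \<omega>)"
      using L_eq by (intro integral_cong_AE) measurable
    finally show ?thesis .
  qed
  show "?E = ?S"
    unfolding mean by (simp add: X_int X_mean)
  have "(\<integral>x. (?L x - ?E)\<^sup>2 \<partial>\<nu>) = Q.expectation (\<lambda>\<omega>. (?L (telescopic_glue q \<omega>) - ?E)\<^sup>2)"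
  proof -
    have "(\<lambda>x. (?L x - c)\<^sup>2) \<in> borel_measurable (seq_space m)" for c by measurable
    from integral_distr[OF glue this] show ?thesis
      by (simp add: \<nu>_def telescopic_measure_def)
  qed
  also have "\<dots> = Q.variance (\<lambda>\<omega>. \<Sum>i\<in>heads_upto q n. X i \<omega>)"
    unfolding mean using L_eq by (intro integral_cong_AE) (measurable, auto)
  also have "\<dots> \<le> (\<Sum>i\<in>heads_upto q n. Q.expectation (\<lambda>\<omega>. (X i \<omega>)\<^sup>2))"
    by (rule Q.variance_sum_indep_le[OF finite_heads_upto indep X_int X2_int])
  also have "\<dots> = (\<Sum>i\<in>heads_upto q n. expectation (\<lambda>x. (block_information m \<mu> (chain_length q n i) x)\<^sup>2))"
    by (simp add: X_second)
  finally show "(\<integral>x. (?L x - ?E)\<^sup>2 \<partial>\<nu>)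
      \<le> (\<Sum>i\<in>heads_upto q n. expectation (\<lambda>x. (block_information m \<mu> (chain_length q n i) x)\<^sup>2))" .
qed

text \<open>
  The strong law for monotone sequences applies to the information of initial words: linear
  variance comes from the second moments, the limit of the means from the
  chain counts.  Division by \<open>ln m\<close> changes the base of the logarithm.
\<close>

lemma (in seq_prob_space) telescopic_local_dimension:
  assumes m: "2 \<le> m" and q: "2 \<le> q"
  shows "has_local_dimension_ae m (telescopic_measure m q \<mu>)
    ((real q - 1)\<^sup>2 / ln (real m) * (\<Sum>k. block_entropy m \<mu> (Suc k) / real q ^ (Suc k + 1)))"
proof -
  define \<nu> where "\<nu> = telescopic_measure m q \<mu>"
  let ?L = "block_information m \<nu>"
  let ?V = "\<lambda>k. expectation (\<lambda>x. (block_information m \<mu> k x)\<^sup>2)"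
  let ?\<alpha> = "\<Sum>j. (real q - 1)\<^sup>2 / real q ^ (j + 2) * block_entropy m \<mu> (Suc j)"
  interpret N: seq_prob_space \<nu> m
    unfolding \<nu>_def by (rule seq_prob_space_telescopic_measure[OF q])
  have H_sum: "summable (\<lambda>j. block_entropy m \<mu> (Suc j) / real q ^ j)"
    by (rule summable_weighted_information[OF m q])
  have "AE x in \<nu>. (\<lambda>n. ?L n x / real n) \<longlonglongrightarrow> ?\<alpha>"
  proof (rule N.strong_law_mono)
    show "AE x in \<nu>. mono (\<lambda>n. ?L n x)"
      using N.AE_cylinders_positive by eventually_elim (rule N.mono_block_information)
    show "integrable \<nu> (?L n)" "integrable \<nu> (\<lambda>x. (?L n x)\<^sup>2)" for n
      by (rule N.block_information_square_integrable)+
    show "N.variance (?L n) \<le> (\<Sum>j. ?V (Suc j) / real q ^ j) * real n" for n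
    proof -
      have "N.variance (?L n) \<le> (\<Sum>i\<in>heads_upto q n. ?V (chain_length q n i))"
        unfolding \<nu>_def by (rule telescopic_information_moments[OF q])
      also have "\<dots> \<le> (\<Sum>j. ?V (Suc j) / real q ^ j) * real n"
        by (rule sum_over_heads_le[OF q _ summable_weighted_information(1)[OF m q]]) simp
      finally show ?thesis .
    qed
    show "(\<lambda>n. N.expectation (?L n) / real n) \<longlonglongrightarrow> ?\<alpha>"
      unfolding \<nu>_def telescopic_information_moments(1)[OF q]
      by (rule tendsto_average_over_heads[OF q]) (use H_sum block_entropy_nonneg in simp)
  qed
  moreover have "?\<alpha> / ln (real m)
      = (real q - 1)\<^sup>2 / ln (real m) * (\<Sum>k. block_entropy m \<mu> (Suc k) / real q ^ (Suc k + 1))"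
  proof -
    have "summable (\<lambda>j. block_entropy m \<mu> (Suc j) / real q ^ (j + 2))"
      using summable_divide[OF H_sum, of "real q ^ 2"]
      by (simp add: power_add power2_eq_square mult_ac)
    from suminf_mult[OF this, of "(real q - 1)\<^sup>2"] show ?thesis by simp
  qed
  ultimately show ?thesis
    unfolding has_local_dimension_ae_def \<nu>_def[symmetric]
  proof (elim eventually_mono)
    fix x assume "(\<lambda>n. ?L n x / real n) \<longlonglongrightarrow> ?\<alpha>"
    then have "(\<lambda>n. ?L n x / real n / ln (real m)) \<longlonglongrightarrow> ?\<alpha> / ln (real m)"
      using m by (intro tendsto_divide tendsto_const) auto
    then show "(\<lambda>n. - log (real m) (N.prob (cylinder m (initial_word x n))) / real n) \<longlonglongrightarrow>
        (real q - 1)\<^sup>2 / ln (real m) * (\<Sum>k. block_entropy m \<mu> (Suc k) / real q ^ (Suc k + 1))"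
      unfolding \<open>?\<alpha> / ln (real m) = _\<close>[symmetric] by (simp add: block_information_def log_def mult.commute)
  qed
qed

theorem theorem1p3:
  fixes m q :: nat and \<mu> :: "(nat \<Rightarrow> nat) measure"
  assumes "m \<ge> 2" and "q \<ge> 2"
    and "sets \<mu> = sets (seq_space m)" and "prob_space \<mu>"
  shows "exact_measure m (telescopic_measure m q \<mu>)
    \<and> summable (\<lambda>k. block_entropy m \<mu> (Suc k) / real q ^ (Suc k + 1))
    \<and> exact_dimension m (telescopic_measure m q \<mu>) =
        (real q - 1)\<^sup>2 / ln (real m)
          * (\<Sum>k. block_entropy m \<mu> (Suc k) / real q ^ (Suc k + 1))"
proof -
  interpret seq_prob_space \<mu> m
    by (intro seq_prob_space.intro seq_prob_space_axioms.intro assms)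
  let ?\<nu> = "telescopic_measure m q \<mu>"
  have prob: "prob_space ?\<nu>" using assms by (intro prob_space_telescopic_measure)
  note dim = telescopic_local_dimension[OF assms(1,2)]
  have "exact_measure m ?\<nu>"
    unfolding exact_measure_def using prob dim by (auto simp: sets_telescopic_measure)
  moreover have "summable (\<lambda>k. block_entropy m \<mu> (Suc k) / real q ^ (Suc k + 1))"
    using summable_divide[OF summable_weighted_information(2)[OF assms(1,2)], of "real q ^ 2"]
    by (simp add: power_add power2_eq_square mult_ac)
  ultimately show ?thesis using exact_dimension_eqI[OF prob dim] by blast
qed

end
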